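(* Let $m, n$ be positive integers and let $a=(a_1, \dots, a_m)$ be a sequence of polynomials with $a_k \in \mathbb{R}_k[x_1, \dots, x_{n-1}]$ for $1\le k\le m$. Then $a$ is a Gårding Nuij sequence if and only if the polynomial $$Q_a(x_1, \dots, x_n) = x_n^m + \sum_{k=1}^m a_k(x_1,\dots,x_{n-1})\, \frac{\partial^k(x_n^m)}{\partial x_n^k}$$ is hyperbolic with respect to the $x_n$ direction.
   Context: $\mathbb{R}_k[x_1,\dots,x_{n-1}]$ denotes the space of real homogeneous polynomials of degree $k$ in $x_1,\dots,x_{n-1}$ (including the zero polynomial). Hyperbolic polynomial: let $P(x_1,\dots,x_n)$ be a real homogeneous polynomial of degree $m$ on $\mathbb{R}^n$ and let $e\in\mathbb{R}^n$. $P$ is hyperbolic with respect to $e$ if for every $x\in\mathbb{R}^n$ the univariate polynomial $t\mapsto P(x+te)$ has only real roots (that is, every $t \in \mathbb{C}$ with $P(x+te)=0$ is real). "Hyperbolic with respect to $x_n$", or "with respect to the $x_n$ direction", means hyperbolic with respect to $e=(0,\dots,0,1)$. Gårding Nuij sequence: a sequence $a=(a_1,\dots,a_m)$ with $a_k\in\mathbb{R}_k[x_1,\dots,x_{n-1}]$ is a Gårding Nuij sequence if for every polynomial $P(x_1,\dots,x_n)$ of degree $m$ that is hyperbolic with respect to the $x_n$ direction, and for every $s\in\mathbb{R}$, the polynomial $$P_{a,s}(x_1,\dots,x_n) := P(x_1,\dots,x_n)+\sum_{k=1}^m a_k(x_1,\dots,x_{n-1})\, s^k\, \frac{\partial^k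 P(x_1,\dots,x_n)}{\partial x_n^k}$$ is hyperbolic with respect to $x_n$. *)

theory Defs
  imports Complex_Main "HOL-Library.Poly_Mapping"
begin

(* Real polynomials in variables x_1, x_2, ...: finitely supported maps from
   monomials (exponent vectors) to coefficients, with the convolution product
   of Poly_Mapping. *)
type_synonym real_mpoly = "(nat \<Rightarrow>\<^sub>0 nat) \<Rightarrow>\<^sub>0 real"

definition var :: "nat \<Rightarrow> real_mpoly" where
  "var i = Poly_Mapping.single (Poly_Mapping.single i 1) 1"

definition const_mpoly :: "real \<Rightarrow> real_mpoly" where
  "const_mpoly c = Poly_Mapping.single 0 c"

definition monomial_degree :: "(nat \<Rightarrow>\<^sub>0 nat) \<Rightarrow> nat" where
  "monomial_degree u = (\<Sum>i\<in>Poly_Mapping.keys u. Poly_Mapping.lookup u i)"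

definition eval_mpoly :: "(nat \<Rightarrow> 'a::real_field) \<Rightarrow> real_mpoly \<Rightarrow> 'a" where
  "eval_mpoly v p =
     (\<Sum>u\<in>Poly_Mapping.keys p. of_real (Poly_Mapping.lookup p u) *
        (\<Prod>i\<in>Poly_Mapping.keys u. v i ^ Poly_Mapping.lookup u i))"

(* Subtraction of exponents is truncated, but a monomial not containing x_i
   gets the coefficient 0 and so contributes nothing. *)
definition partial_deriv :: "nat \<Rightarrow> real_mpoly \<Rightarrow> real_mpoly" where
  "partial_deriv i p =
     (\<Sum>u\<in>Poly_Mapping.keys p.
        Poly_Mapping.single (u - Poly_Mapping.single i 1)
          (real (Poly_Mapping.lookup u i) * Poly_Mapping.lookup p u))"

(* The space R_k[x_1,...,x_n], zero polynomial included; it is R_k[] for n = 0. *)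
definition homogeneous_polys :: "nat \<Rightarrow> nat \<Rightarrow> real_mpoly set" where
  "homogeneous_polys n k =
     {p. \<forall>u\<in>Poly_Mapping.keys p. Poly_Mapping.keys u \<subseteq> {1..n} \<and> monomial_degree u = k}"

(* Points of R^n are functions nat => real, of which only the values at 1..n
   matter because P involves only x_1,...,x_n.  The condition at x = 0, t = i forces
   P(e) to be nonzero when m > 0; in particular the zero polynomial is never hyperbolic,
   so P has degree exactly m. *)
definition hyperbolic :: "nat \<Rightarrow> nat \<Rightarrow> (nat \<Rightarrow> real) \<Rightarrow> real_mpoly \<Rightarrow> bool" where
  "hyperbolic n m e P \<longleftrightarrow>
     P \<in> homogeneous_polys n m \<and>
     (\<forall>x::nat \<Rightarrow> real. \<forall>t::complex.
        eval_mpoly (\<lambda>i. of_real (x i) + t * of_real (e i)) P = 0 \<longrightarrow> t \<in> \<real>)"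

definition axis_vec :: "nat \<Rightarrow> nat \<Rightarrow> real" where
  "axis_vec j = (\<lambda>i. if i = j then 1 else 0)"

definition perturbed :: "nat \<Rightarrow> nat \<Rightarrow> (nat \<Rightarrow> real_mpoly) \<Rightarrow> real \<Rightarrow> real_mpoly \<Rightarrow> real_mpoly" where
  "perturbed n m a s P =
     P + (\<Sum>k=1..m. a k * const_mpoly (s ^ k) * (partial_deriv n ^^ k) P)"

(* The sequence (a_1,...,a_m) is given by the values of a at 1..m. *)
definition Garding_Nuij :: "nat \<Rightarrow> nat \<Rightarrow> (nat \<Rightarrow> real_mpoly) \<Rightarrow> bool" where
  "Garding_Nuij n m a \<longleftrightarrow>
     (\<forall>k\<in>{1..m}. a k \<in> homogeneous_polys (n - 1) k) \<and>
     (\<forall>P s. hyperbolic n m (axis_vec n) P \<longrightarrow>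
        hyperbolic n m (axis_vec n) (perturbed n m a s P))"

end

theory Submission
  imports Defs "HOL-Computational_Algebra.Fundamental_Theorem_Algebra"
begin

text \<open>Restrict everything to a line \<open>t \<mapsto> x + t e\<close> in direction \<open>x\<^sub>n\<close>. The polynomials \<open>a\<^sub>k\<close> are
  constant on the line and \<open>\<partial>/\<partial>x\<^sub>n\<close> becomes \<open>d/dt\<close>, so the perturbation acts on the univariate
  polynomial \<open>p\<close> that \<open>P\<close> induces as a differential operator \<open>T = \<Sum> c\<^sub>k d\<^sup>k/dt\<^sup>k\<close> with constant
  coefficients, \<open>c\<^sub>0 = 1\<close> and \<open>c\<^sub>k = a\<^sub>k(x) s\<^sup>k\<close>. By homogeneity \<open>c\<^sub>k = a\<^sub>k(s x)\<close>; so \<open>Q\<^sub>a\<close>, on the line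
  through \<open>s x\<close>, becomes the image under the same \<open>T\<close> of a translate of \<open>t\<^sup>m\<close>.

  What remains is a theorem of Walsh: if \<open>T (t\<^sup>m)\<close> has only real roots, so has \<open>T p\<close> for each \<open>p\<close> of
  degree \<open>m\<close> with only real roots (lemma \<open>diff_operator_nonzero_upper_half_plane\<close>). It comes from
  Grace's theorem, here in the form that a linear functional on polynomials which does not vanish
  on \<open>(X - r)\<^sup>m\<close> for \<open>r\<close> in a half-plane does not vanish on \<open>(X - r\<^sub>1) \<dots> (X - r\<^sub>m)\<close> for \<open>r\<^sub>i\<close> in
  that half-plane (lemma \<open>grace_linear_functional\<close>), applied to \<open>p \<mapsto> (T p)(z)\<close> with \<open>Im z > 0\<close>.
  Grace's theorem follows by induction on the number of roots; the induction step is Laguerre's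
  theorem on polar derivatives (lemma \<open>laguerre_polar_derivative_nonzero\<close>), which rests on the
  convexity of the image of a half-plane under inversion.

  Conversely \<open>Q\<^sub>a\<close> is itself the perturbation of the hyperbolic polynomial \<open>x\<^sub>n\<^sup>m\<close> with \<open>s = 1\<close>.\<close>

section \<open>Laguerre's theorem for a half-plane\<close>

text \<open>Inversion turns the half-plane \<open>Im b \<le> - h\<close> into the punctured disk with centre \<open>\<i>/2h\<close> whose
  missing point \<open>0\<close> lies on the boundary.\<close>
lemma inverse_in_disk_iff:
  fixes b :: complex assumes "h > 0" "b \<noteq> 0"
  shows "norm (1 / b - \<i> / of_real (2 * h)) \<le> 1 / (2 * h) \<longleftrightarrow> Im b \<le> - h"
proof -
  have "1 / b - \<i> / of_real (2 * h) = (of_real (2*h) - \<i> * b) / (of_real (2*h) * b)"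
    using assms by (simp add: field_simps)
  then have "norm (1 / b - \<i> / of_real (2 * h)) = norm (of_real (2*h) - \<i> * b) / (2 * h * norm b)"
    using assms by (simp add: norm_divide norm_mult)
  then have "norm (1 / b - \<i> / of_real (2 * h)) \<le> 1 / (2 * h) \<longleftrightarrow> norm (of_real (2*h) - \<i> * b) \<le> norm b"
    using assms by (simp only:) (simp add: divide_le_eq)
  also have "\<dots> \<longleftrightarrow> (norm (of_real (2*h) - \<i> * b))^2 \<le> (norm b)^2"
    by (simp add: abs_le_square_iff[symmetric])
  also have "\<dots> \<longleftrightarrow> 4 * h * (h + Im b) \<le> 0"
    unfolding cmod_power2 by (simp add: power2_eq_square algebra_simps)
  also have "\<dots> \<longleftrightarrow> Im b \<le> - h" using assms by (auto simp: mult_le_0_iff)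
  finally show ?thesis .
qed

text \<open>The logarithmic derivative at \<open>r\<close> is the sum of the numbers \<open>1 / (r - w)\<close> over the roots
  \<open>w\<close>, with multiplicity. Each of these lies in the disk of the previous lemma, so their sum lies in that disk scaled
  by the degree.\<close>
lemma log_derivative_in_disk:
  fixes f :: "complex poly"
  assumes "h > 0" and "f \<noteq> 0" and "\<And>w. poly f w = 0 \<Longrightarrow> Im w \<ge> Im r + h"
  shows "norm (poly (pderiv f) r / poly f r - of_nat (degree f) * (\<i> / of_real (2 * h)))
           \<le> real (degree f) / (2 * h)"
  using assms(2,3)
proof (induction "degree f" arbitrary: f)
  case 0
  then obtain c where "f = [:c:]" by (metis degree_eq_zeroE)
  then show ?case by (simp add: pderiv_pCons)
next
  case (Suc d)
  then have "\<not> constant (poly f)" by (simp add: constant_degree)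
  then obtain a where a: "poly f a = 0" using fundamental_theorem_of_algebra by blast
  then obtain g where f: "f = [:-a, 1:] * g" by (metis dvd_def poly_eq_0_iff_dvd)
  have g0: "g \<noteq> 0" using Suc.prems f by auto
  have deg: "degree f = Suc (degree g)" unfolding f using g0 by (subst degree_mult_eq) auto
  have g_roots: "Im w \<ge> Im r + h" if "poly g w = 0" for w
    using Suc.prems(2)[of w] that by (simp add: f)
  have IH: "norm (poly (pderiv g) r / poly g r - of_nat (degree g) * (\<i> / of_real (2 * h)))
           \<le> real (degree g) / (2 * h)"
    using Suc.hyps(1)[of g] Suc.hyps(2) deg g0 g_roots by simp
  have Ima: "Im a \<ge> Im r + h" using Suc.prems(2) a by blast
  then have ra: "r \<noteq> a" using assms(1) by auto
  have gr: "poly g r \<noteq> 0" using g_roots[of r] assms(1) by auto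
  define u where "u = 1 / (r - a)"
  have "poly (pderiv f) r / poly f r = u + poly (pderiv g) r / poly g r"
    unfolding f pderiv_mult u_def using ra gr
    by (simp add: pderiv_pCons field_simps)
  moreover have "norm (u - \<i> / of_real (2 * h)) \<le> 1 / (2 * h)"
    unfolding u_def using inverse_in_disk_iff[OF assms(1), of "r - a"] ra Ima by simp
  ultimately show ?case
    using IH norm_triangle_ineq[of "u - \<i> / of_real (2 * h)"
      "poly (pderiv g) r / poly g r - of_nat (degree g) * (\<i> / of_real (2 * h))"]
    by (simp add: deg algebra_simps add_divide_distrib)
qed

text \<open>Laguerre's theorem for a half-plane. A zero of the polar derivative would mean
  \<open>f'(r)/f(r) = m / (r - \<rho>)\<close>. The left side is a sum of \<open>degree f\<close> points of a disk whose
  boundary contains \<open>0\<close>; padded with zeros it is a sum of \<open>m\<close> points of this disk. Convexity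
  then places \<open>1 / (r - \<rho>)\<close> in the disk, which is false for \<open>\<rho>\<close> in the open half-plane.\<close>
lemma laguerre_polar_derivative_nonzero:
  fixes f :: "complex poly"
  assumes deg: "degree f \<le> m" and "m > 0" and f: "\<And>w. Im w < c \<Longrightarrow> poly f w \<noteq> 0"
    and r: "Im r < c" and rho: "Im \<rho> < c"
  shows "of_nat m * poly f r + (\<rho> - r) * poly (pderiv f) r \<noteq> 0"
proof
  assume *: "of_nat m * poly f r + (\<rho> - r) * poly (pderiv f) r = 0"
  define h where "h = c - Im r"
  define i where "i = \<i> / of_real (2 * h)"
  define l where "l = poly (pderiv f) r / poly f r"
  have h: "h > 0" using r by (simp add: h_def)
  have fr: "poly f r \<noteq> 0" using f r by blast
  have "\<rho> \<noteq> r" using * fr \<open>m > 0\<close> by auto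
  then have l: "l = of_nat m * (1 / (r - \<rho>))"
    using * fr unfolding l_def by (simp add: field_simps)
  have ni: "norm i = 1 / (2 * h)" using h by (simp add: i_def norm_divide norm_mult)
  have "real m * norm (1 / (r - \<rho>) - i) = norm (l - of_nat m * i)"
    unfolding l right_diff_distrib[symmetric] by (simp only: norm_mult norm_of_nat)
  \<comment> \<open>The \<open>m - degree f\<close> zeros that pad the sum of inverses also lie in the disk, on its boundary.\<close>
  also have "l - of_nat m * i = (l - of_nat (degree f) * i) - of_nat (m - degree f) * i"
    using deg by (simp add: of_nat_diff algebra_simps)
  also have "norm \<dots> \<le> norm (l - of_nat (degree f) * i) + norm (of_nat (m - degree f) * i)"
    by (rule norm_triangle_ineq4)
  also have "norm (l - of_nat (degree f) * i) \<le> real (degree f) / (2 * h)"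
    unfolding l_def i_def using h fr f
    by (intro log_derivative_in_disk) (auto simp: h_def not_less[symmetric])
  also have "norm (of_nat (m - degree f) * i) = real (m - degree f) / (2 * h)"
    by (simp add: norm_mult ni del: of_nat_diff)
  also have "real (degree f) / (2 * h) + real (m - degree f) / (2 * h) = real m * (1 / (2 * h))"
    using deg by (simp add: of_nat_diff add_divide_distrib[symmetric])
  finally have "norm (1 / (r - \<rho>) - i) \<le> 1 / (2 * h)" using \<open>m > 0\<close> by (simp only: mult_le_cancel_left_pos of_nat_0_less_iff)
  then have "Im (r - \<rho>) \<le> - h" unfolding i_def using inverse_in_disk_iff[OF h, of "r - \<rho>"] \<open>\<rho> \<noteq> r\<close> by simp
  then show False using rho by (simp add: h_def)
qed

section \<open>Grace's theorem for linear functionals\<close>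

definition linear_functional :: "(complex poly \<Rightarrow> complex) \<Rightarrow> bool" where
  "linear_functional L \<longleftrightarrow> (\<forall>p q. L (p + q) = L p + L q) \<and> (\<forall>c p. L (smult c p) = c * L p)"

lemma linear_functionalD: assumes "linear_functional L" shows "L (p + q) = L p + L q" "L (smult c p) = c * L p"
  using assms by (auto simp: linear_functional_def)

lemma linear_functional_mult: "linear_functional L \<Longrightarrow> linear_functional (\<lambda>p. L (g * p))"
  by (simp add: linear_functional_def distrib_left)

text \<open>\<open>F\<close> and its derivative record how a functional acts on \<open>(X - r)\<^sup>m\<close> as \<open>r\<close> varies. This is
  what makes Laguerre's theorem, a statement about polynomials, applicable to functionals.\<close>
lemma linear_functional_on_powers:
  assumes "linear_functional L"
  shows "\<exists>F. degree F \<le> m \<and> (\<forall>r. poly F r = L ([:-r,1:]^m) \<and>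
    poly (pderiv F) r = - of_nat m * L ([:-r,1:]^(m-1)))"
  using assms
proof (induction m arbitrary: L)
  case 0
  then show ?case by (intro exI[of _ "[:L 1:]"]) (auto simp: pderiv_pCons)
next
  case (Suc m)
  obtain F where F: "degree F \<le> m" "\<And>r. poly F r = L ([:-r,1:]^m)"
    "\<And>r. poly (pderiv F) r = - of_nat m * L ([:-r,1:]^(m-1))" using Suc by metis
  obtain G where G: "degree G \<le> m" "\<And>r. poly G r = L ([:0,1:] * [:-r,1:]^m)"
    "\<And>r. poly (pderiv G) r = - of_nat m * L ([:0,1:] * [:-r,1:]^(m-1))"
    using Suc.IH[OF linear_functional_mult[OF Suc.prems, of "[:0,1:]"]] by metis
  have split: "L ([:-r,1:] * p) = L ([:0,1:] * p) - r * L p" for r p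
  proof -
    have "[:-r,1:] * p = [:0,1:] * p + smult (-r) p" by simp
    then show ?thesis using linear_functionalD[OF Suc.prems] by (metis add_uminus_conv_diff mult_minus_left)
  qed
  \<comment> \<open>From \<open>(X - r)\<^sup>m\<^sup>+\<^sup>1 = X (X - r)\<^sup>m - r (X - r)\<^sup>m\<close>; the factor \<open>[:0,1:]\<close> of \<open>F\<close> is the variable \<open>r\<close>.\<close>
  have "poly (G - [:0,1:] * F) r = L ([:-r,1:]^Suc m)" for r
    using split[of r "[:-r,1:]^m"] F G by simp
  moreover have "degree (G - [:0,1:] * F) \<le> Suc m"
    using F(1) G(1) by (intro degree_diff_le order.trans[OF degree_mult_le]) auto
  moreover have "poly (pderiv (G - [:0,1:] * F)) r = - of_nat (Suc m) * L ([:-r,1:]^(Suc m - 1))" for r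
  proof (cases m)
    case 0
    then show ?thesis using F G by (simp add: pderiv_diff pderiv_mult pderiv_pCons)
  next
    case (Suc k)
    have "L ([:-r,1:]^m) = L ([:0,1:] * [:-r,1:]^k) - r * L ([:-r,1:]^k)"
      using split[of r "[:-r,1:]^k"] Suc by simp
    moreover have "poly (pderiv (G - [:0,1:] * F)) r = poly (pderiv G) r - (poly F r + r * poly (pderiv F) r)"
      by (simp add: pderiv_diff pderiv_mult pderiv_pCons)
    then have "poly (pderiv (G - [:0,1:] * F)) r = - of_nat m * L ([:0,1:] * [:-r,1:]^k)
        - (L ([:-r,1:]^m) - r * (of_nat m * L ([:-r,1:]^k)))"
      unfolding F(2,3) G(3) by (simp only: Suc diff_Suc_1 mult_minus_left mult_minus_right add_uminus_conv_diff)
    moreover have "- M * A - (C - r * (M * B)) = - (1 + M) * C" if "C = A - r * B" for A B C M :: complex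
      unfolding that by (simp add: algebra_simps)
    ultimately show ?thesis by (metis Suc_eq_plus1_left diff_Suc_1 of_nat_Suc)
  qed
  ultimately show ?case by blast
qed

text \<open>Grace's theorem, read as a coincidence principle: a functional that does not vanish on the
  powers \<open>(X - r)\<^sup>m\<close> with \<open>r\<close> in a half-plane does not vanish on products of \<open>m\<close>
  different linear factors \<open>X - r\<^sub>i\<close> either, as long as all \<open>r\<^sub>i\<close> lie in it. The induction absorbs one root \<open>\<rho>\<close> into the functional,
  \<open>p \<mapsto> L ((X - \<rho>) p)\<close>. Its value at \<open>(X - r)\<^sup>m\<^sup>-\<^sup>1\<close> is, up to the factor \<open>m\<close>, the polar derivative
  at \<open>\<rho>\<close> of \<open>r \<mapsto> L ((X - r)\<^sup>m)\<close>, hence nonzero by Laguerre's theorem.\<close>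
lemma grace_linear_functional:
  assumes "linear_functional L" "\<And>r. Im r < c \<Longrightarrow> L ([:-r,1:] ^ length rs) \<noteq> 0"
    and "\<And>r. r \<in> set rs \<Longrightarrow> Im r < c"
  shows "L (\<Prod>r\<leftarrow>rs. [:-r,1:]) \<noteq> 0"
  using assms
proof (induction rs arbitrary: L)
  case Nil
  then show ?case using Nil.prems(2)[of "Complex 0 (c - 1)"] by simp
next
  case (Cons \<rho> rs)
  let ?m = "Suc (length rs)"
  have "L ([:-\<rho>,1:] * [:-r,1:] ^ length rs) \<noteq> 0" if r: "Im r < c" for r
  proof -
    obtain F where F: "degree F \<le> ?m" "\<And>r. poly F r = L ([:-r,1:]^?m)"
      "\<And>r. poly (pderiv F) r = - of_nat ?m * L ([:-r,1:]^length rs)"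
      using linear_functional_on_powers[OF Cons.prems(1), of ?m] by (metis diff_Suc_1)
    have "of_nat ?m * poly F r + (\<rho> - r) * poly (pderiv F) r \<noteq> 0"
      using F Cons.prems r by (intro laguerre_polar_derivative_nonzero[where c=c]) auto
    moreover have "[:-\<rho>,1:] * [:-r,1:] ^ length rs = [:-r,1:] ^ ?m + smult (r - \<rho>) ([:-r,1:] ^ length rs)"
    proof -
      have "[:-\<rho>,1:] = [:-r,1:] + [:r-\<rho>:]" by simp
      then have "[:-\<rho>,1:] * [:-r,1:] ^ length rs = [:-r,1:] * [:-r,1:] ^ length rs + [:r-\<rho>:] * [:-r,1:] ^ length rs"
        by (metis distrib_right)
      then show ?thesis by (simp only: power_Suc) simp
    qed
    then have "L ([:-\<rho>,1:] * [:-r,1:] ^ length rs) = poly F r + (r - \<rho>) * L ([:-r,1:] ^ length rs)"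
      using linear_functionalD[OF Cons.prems(1)] F(2) by metis
    then have "of_nat ?m * L ([:-\<rho>,1:] * [:-r,1:] ^ length rs) = of_nat ?m * poly F r + (\<rho> - r) * poly (pderiv F) r"
      unfolding F(3) by algebra
    ultimately show ?thesis by auto
  qed
  then have "L ([:-\<rho>,1:] * (\<Prod>r\<leftarrow>rs. [:-r,1:])) \<noteq> 0"
    using Cons.prems(3) by (intro Cons.IH[OF linear_functional_mult[OF Cons.prems(1)]]) auto
  then show ?case by (simp only: list.map prod_list.Cons not_False_eq_True)
qed

section \<open>Differential operators with constant coefficients\<close>

definition diff_operator :: "nat \<Rightarrow> (nat \<Rightarrow> complex) \<Rightarrow> complex poly \<Rightarrow> complex poly" where
  "diff_operator m c p = (\<Sum>k\<le>m. smult (c k) ((pderiv ^^ k) p))"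

lemma pderiv_iter_add: "(pderiv ^^ k) (p + q) = (pderiv ^^ k) p + (pderiv ^^ k) (q::'a::idom poly)"
  by (induction k) (simp_all add: pderiv_add)

lemma pderiv_iter_smult: "(pderiv ^^ k) (smult c p) = smult c ((pderiv ^^ k) (p::'a::idom poly))"
  by (induction k) (simp_all add: pderiv_smult)

lemma pderiv_iter_translate: "(pderiv ^^ k) (p \<circ>\<^sub>p [:a,1:]) = ((pderiv ^^ k) p) \<circ>\<^sub>p [:a,1::'a::idom:]"
  by (induction k) (simp_all add: pderiv_pcompose pderiv_pCons)

lemma diff_operator_translate: "diff_operator m c (p \<circ>\<^sub>p [:a,1:]) = (diff_operator m c p) \<circ>\<^sub>p [:a,1:]"
  by (simp add: diff_operator_def pderiv_iter_translate pcompose_sum pcompose_smult)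

lemma pcompose_power: "(p ^ k) \<circ>\<^sub>p q = (p \<circ>\<^sub>p q) ^ k" for p :: "'a::comm_ring_1 poly"
  by (induction k) (simp_all add: pcompose_1 pcompose_mult)

lemma complex_poly_factorization: "\<exists>rs. length rs = degree p \<and> p = smult (lead_coeff p) (\<Prod>r\<leftarrow>rs. [:-r,1:])" for p :: "complex poly"
proof (induction "degree p" arbitrary: p)
  case 0
  then show ?case by (auto elim!: degree_eq_zeroE)
next
  case (Suc d)
  then have "\<not> constant (poly p)" by (simp add: constant_degree)
  then obtain a where a: "poly p a = 0" using fundamental_theorem_of_algebra by blast
  then obtain g where f: "p = [:-a, 1:] * g" by (metis dvd_def poly_eq_0_iff_dvd)
  have g0: "g \<noteq> 0" using Suc.hyps f by auto
  have deg: "degree p = Suc (degree g)" unfolding f using g0 by (subst degree_mult_eq) auto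
  then obtain rs where "length rs = degree g" "g = smult (lead_coeff g) (\<Prod>r\<leftarrow>rs. [:-r,1:])"
    using Suc by auto
  moreover have "lead_coeff p = lead_coeff g" unfolding f by (simp only: lead_coeff_mult) simp
  ultimately show ?case using deg f by (intro exI[of _ "a # rs"]) (metis (no_types, lifting) length_Cons list.simps(9) mult_smult_right prod_list.Cons)
qed

text \<open>Walsh's theorem on composing polynomials by a differential operator with constant coefficients.
  For fixed \<open>z\<close> Grace's theorem applies to the functional \<open>p \<mapsto> (T p)(z)\<close>: since \<open>T\<close> commutes with
  translations, its value at \<open>(X - r)\<^sup>m\<close> is a value of \<open>T ((X + b)\<^sup>m)\<close> at a point with imaginary
  part \<open>Im z - Im r\<close>. The power \<open>(X + b)\<^sup>m\<close> with real \<open>b\<close> stands in for \<open>X\<^sup>m\<close> because it is what a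
  line in direction \<open>x\<^sub>n\<close> cuts out of \<open>x\<^sub>n\<^sup>m\<close>.\<close>
lemma diff_operator_nonzero_upper_half_plane:
  fixes p :: "complex poly" and b :: real
  assumes deg: "degree p = m" "p \<noteq> 0" and p: "\<And>r. poly p r = 0 \<Longrightarrow> Im r \<le> 0"
    and q: "\<And>w. Im w > 0 \<Longrightarrow> poly (diff_operator N c ([:of_real b,1:] ^ m)) w \<noteq> 0"
    and z: "Im z > 0"
  shows "poly (diff_operator N c p) z \<noteq> 0"
proof -
  define L where "L p = poly (diff_operator N c p) z" for p
  have L: "linear_functional L"
    by (auto simp: linear_functional_def L_def diff_operator_def pderiv_iter_add pderiv_iter_smult smult_add_right
        sum.distrib poly_sum sum_distrib_left algebra_simps)
  obtain rs where rs: "length rs = m" "p = smult (lead_coeff p) (\<Prod>r\<leftarrow>rs. [:-r,1:])"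
    using complex_poly_factorization deg by blast
  have "L ([:-r,1:] ^ length rs) \<noteq> 0" if "Im r < Im z" for r
  proof -
    have "[:-r,1:] = [:of_real b,1:] \<circ>\<^sub>p [:-r - of_real b,1:]" by (simp add: pcompose_pCons)
    then have "[:-r,1:] ^ m = ([:of_real b,1:]^m) \<circ>\<^sub>p [:-r - of_real b,1:]"
      by (simp only: pcompose_power)
    then have "L ([:-r,1:] ^ m) = poly (diff_operator N c ([:of_real b,1:] ^ m)) (z - r - of_real b)"
      by (simp only: L_def diff_operator_translate poly_pcompose) (simp add: algebra_simps)
    then show ?thesis using q[of "z - r - of_real b"] that rs by simp
  qed
  moreover have "Im r < Im z" if "r \<in> set rs" for r
  proof -
    have "poly (\<Prod>r\<leftarrow>rs. [:-r,1:]) r = 0" using that by (induction rs) auto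
    then have "poly p r = 0" using arg_cong[OF rs(2), of "\<lambda>p. poly p r"] by simp
    then show ?thesis using p z by fastforce
  qed
  ultimately have "L (\<Prod>r\<leftarrow>rs. [:-r,1:]) \<noteq> 0" by (rule grace_linear_functional[OF L])
  then have "L p \<noteq> 0"
    using arg_cong[OF rs(2), of L] deg(2) leading_coeff_0_iff[of p] linear_functionalD(2)[OF L] by (metis mult_eq_0_iff)
  then show ?thesis by (simp add: L_def)
qed

section \<open>Evaluation of multivariate polynomials\<close>

text \<open>The support of a product of monomials depends on the factors; over a common finite superset of
  the supports the exponents simply add up.\<close>
lemma monomial_superset:
  assumes "finite A" "Poly_Mapping.keys u \<subseteq> A"
  shows "(\<Prod>i\<in>Poly_Mapping.keys u. (v i :: 'a::comm_monoid_mult) ^ Poly_Mapping.lookup u i)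
    = (\<Prod>i\<in>A. v i ^ Poly_Mapping.lookup u i)"
  using assms by (intro prod.mono_neutral_left) (auto simp: in_keys_iff)

lemma monomial_degree_superset:
  assumes "finite A" "Poly_Mapping.keys u \<subseteq> A"
  shows "monomial_degree u = (\<Sum>i\<in>A. Poly_Mapping.lookup u i)"
  unfolding monomial_degree_def using assms by (intro sum.mono_neutral_left) (auto simp: in_keys_iff)

lemma monomial_add:
  "(\<Prod>i\<in>Poly_Mapping.keys (u + w). (v i :: 'a::comm_monoid_mult) ^ Poly_Mapping.lookup (u + w) i)
   = (\<Prod>i\<in>Poly_Mapping.keys u. v i ^ Poly_Mapping.lookup u i) *
     (\<Prod>i\<in>Poly_Mapping.keys w. v i ^ Poly_Mapping.lookup w i)"
proof -
  let ?A = "Poly_Mapping.keys u \<union> Poly_Mapping.keys w"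
  have fin: "finite ?A" by simp
  show ?thesis
    unfolding monomial_superset[OF fin keys_add] monomial_superset[OF fin Un_upper1]
      monomial_superset[OF fin Un_upper2]
    by (simp add: lookup_add power_add prod.distrib)
qed

lemma monomial_degree_add: "monomial_degree (u + w) = monomial_degree u + monomial_degree w"
proof -
  let ?A = "Poly_Mapping.keys u \<union> Poly_Mapping.keys w"
  have "finite ?A" "Poly_Mapping.keys (u + w) \<subseteq> ?A" by (auto dest: subsetD[OF keys_add])
  then show ?thesis
    by (simp add: monomial_degree_superset[of ?A u] monomial_degree_superset[of ?A w]
        monomial_degree_superset[of ?A "u + w"] lookup_add sum.distrib)
qed

lemma eval_mpoly_superset:
  assumes "finite A" "Poly_Mapping.keys p \<subseteq> A"
  shows "eval_mpoly v p = (\<Sum>u\<in>A. of_real (Poly_Mapping.lookup p u) *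
        (\<Prod>i\<in>Poly_Mapping.keys u. v i ^ Poly_Mapping.lookup u i))"
  unfolding eval_mpoly_def using assms by (intro sum.mono_neutral_left) (auto simp: in_keys_iff)

lemma eval_mpoly_add: "eval_mpoly v (p + q) = eval_mpoly v p + eval_mpoly v q"
proof -
  let ?A = "Poly_Mapping.keys p \<union> Poly_Mapping.keys q"
  have "finite ?A" "Poly_Mapping.keys (p + q) \<subseteq> ?A" by (auto dest: subsetD[OF keys_add])
  then show ?thesis
    by (simp add: eval_mpoly_superset[of ?A] lookup_add distrib_right sum.distrib)
qed

lemma eval_mpoly_sum: "eval_mpoly v (sum f A) = (\<Sum>a\<in>A. eval_mpoly v (f a))"
  by (induction A rule: infinite_finite_induct) (simp_all add: eval_mpoly_add, simp_all add: eval_mpoly_def)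

lemma eval_mpoly_single: "eval_mpoly v (Poly_Mapping.single u c) =
    of_real c * (\<Prod>i\<in>Poly_Mapping.keys u. v i ^ Poly_Mapping.lookup u i)"
  by (subst eval_mpoly_superset[of "{u}"]) auto

lemma mpoly_sum_singles: "(\<Sum>u\<in>Poly_Mapping.keys p. Poly_Mapping.single u (Poly_Mapping.lookup p u)) = p"
  by (intro poly_mapping_eqI) (auto simp: lookup_sum lookup_single when_def in_keys_iff sum.delta)

lemma eval_mpoly_mult: "eval_mpoly v (p * q) = eval_mpoly v p * eval_mpoly v q"
proof -
  have "p * q = (\<Sum>u\<in>Poly_Mapping.keys p. Poly_Mapping.single u (Poly_Mapping.lookup p u)) *
      (\<Sum>w\<in>Poly_Mapping.keys q. Poly_Mapping.single w (Poly_Mapping.lookup q w))"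
    by (simp only: mpoly_sum_singles)
  also have "\<dots> = (\<Sum>u\<in>Poly_Mapping.keys p. \<Sum>w\<in>Poly_Mapping.keys q.
      Poly_Mapping.single (u + w) (Poly_Mapping.lookup p u * Poly_Mapping.lookup q w))"
    by (simp only: sum_product mult_single)
  also have "eval_mpoly v \<dots> = eval_mpoly v p * eval_mpoly v q"
    unfolding eval_mpoly_def[of v p] eval_mpoly_def[of v q]
    by (simp only: eval_mpoly_sum eval_mpoly_single monomial_add sum_product of_real_mult mult_ac)
  finally show ?thesis .
qed

lemma eval_mpoly_const: "eval_mpoly v (const_mpoly c) = of_real c"
  by (simp add: const_mpoly_def eval_mpoly_single)

lemma var_power_eq_single: "var n ^ k = Poly_Mapping.single (Poly_Mapping.single n k) 1"
  by (induction k) (simp_all add: var_def mult_single single_add[symmetric])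

lemma eval_mpoly_var_power: "eval_mpoly v (var n ^ k) = v n ^ k"
  by (simp add: var_power_eq_single eval_mpoly_single)

lemma eval_mpoly_of_real: "eval_mpoly (\<lambda>i. of_real (x i) :: 'a::real_field) p = of_real (eval_mpoly x p)"
  by (simp add: eval_mpoly_def)

lemma eval_mpoly_cnj: "eval_mpoly (\<lambda>i. cnj (v i)) p = cnj (eval_mpoly v p)"
  by (simp add: eval_mpoly_def)

lemma eval_mpoly_scale:
  assumes "p \<in> homogeneous_polys n k"
  shows "eval_mpoly (\<lambda>i. s * v i) p = s ^ k * eval_mpoly v p"
proof -
  have "(\<Prod>i\<in>Poly_Mapping.keys u. (s * v i) ^ Poly_Mapping.lookup u i)
      = s ^ k * (\<Prod>i\<in>Poly_Mapping.keys u. v i ^ Poly_Mapping.lookup u i)"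
    if "u \<in> Poly_Mapping.keys p" for u
    using assms that by (simp add: homogeneous_polys_def monomial_degree_def power_mult_distrib
        prod.distrib flip: power_sum)
  then show ?thesis
    by (simp add: eval_mpoly_def sum_distrib_left mult_ac)
qed

lemma eval_mpoly_cong:
  assumes "p \<in> homogeneous_polys n k" "\<And>i. i \<in> {1..n} \<Longrightarrow> v i = w i"
  shows "eval_mpoly v p = eval_mpoly w p"
proof -
  have "v i = w i" if "u \<in> Poly_Mapping.keys p" "i \<in> Poly_Mapping.keys u" for u i
    using assms that unfolding homogeneous_polys_def by blast
  then show ?thesis by (simp add: eval_mpoly_def)
qed

section \<open>Homogeneous polynomials\<close>

lemma homogeneous_add: "p \<in> homogeneous_polys n k \<Longrightarrow> q \<in> homogeneous_polys n k \<Longrightarrow> p + q \<in> homogeneous_polys n k"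
  using keys_add[of p q] unfolding homogeneous_polys_def by blast

lemma homogeneous_sum: "(\<And>a. a \<in> A \<Longrightarrow> f a \<in> homogeneous_polys n k) \<Longrightarrow> sum f A \<in> homogeneous_polys n k"
  by (induction A rule: infinite_finite_induct) (auto intro!: homogeneous_add, auto simp: homogeneous_polys_def)

lemma homogeneous_mult:
  assumes "p \<in> homogeneous_polys n k" "q \<in> homogeneous_polys n l"
  shows "p * q \<in> homogeneous_polys n (k + l)"
  unfolding homogeneous_polys_def
proof (intro CollectI ballI)
  fix u assume "u \<in> Poly_Mapping.keys (p * q)"
  then obtain a b where "u = a + b" "a \<in> Poly_Mapping.keys p" "b \<in> Poly_Mapping.keys q"
    using keys_mult by blast
  then show "Poly_Mapping.keys u \<subseteq> {1..n} \<and> monomial_degree u = k + l"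
    using assms keys_add[of a b] by (fastforce simp: homogeneous_polys_def monomial_degree_add)
qed

lemma homogeneous_single: "Poly_Mapping.keys u \<subseteq> {1..n} \<Longrightarrow> monomial_degree u = k \<Longrightarrow>
    Poly_Mapping.single u c \<in> homogeneous_polys n k"
  by (auto simp: homogeneous_polys_def split: if_splits)

lemma homogeneous_zero: "0 \<in> homogeneous_polys n k"
  by (simp add: homogeneous_polys_def)

lemma homogeneous_const: "const_mpoly c \<in> homogeneous_polys n 0"
  by (auto simp: homogeneous_polys_def const_mpoly_def monomial_degree_def)

lemma homogeneous_mono: "p \<in> homogeneous_polys n k \<Longrightarrow> n \<le> N \<Longrightarrow> p \<in> homogeneous_polys N k"
  unfolding homogeneous_polys_def by fastforce

lemma homogeneous_deriv:
  assumes "p \<in> homogeneous_polys n k"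
  shows "partial_deriv j p \<in> homogeneous_polys n (k - 1)"
  unfolding partial_deriv_def
proof (rule homogeneous_sum)
  fix u assume u: "u \<in> Poly_Mapping.keys p"
  let ?w = "u - Poly_Mapping.single j 1"
  show "Poly_Mapping.single ?w (real (Poly_Mapping.lookup u j) * Poly_Mapping.lookup p u) \<in> homogeneous_polys n (k - 1)"
  \<comment> \<open>If \<open>x\<^sub>j\<close> does not occur, the exponent subtraction is truncated, but the coefficient is zero.\<close>
  proof (cases "Poly_Mapping.lookup u j = 0")
    case True
    then show ?thesis by (simp add: homogeneous_zero)
  next
    case False
    have "u = ?w + Poly_Mapping.single j 1"
      using False by (intro poly_mapping_eqI) (auto simp: lookup_add lookup_minus lookup_single when_def)
    then have "monomial_degree u = monomial_degree ?w + 1"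
      by (metis monomial_degree_add monomial_degree_superset[of "{j}" "Poly_Mapping.single j 1"] finite.intros
          keys_single lookup_single_eq order_refl sum.insert sum.empty empty_iff add_0_right one_neq_zero)
    moreover have "Poly_Mapping.keys ?w \<subseteq> Poly_Mapping.keys u" by (auto simp: in_keys_iff lookup_minus)
    moreover have "Poly_Mapping.keys u \<subseteq> {1..n}" "monomial_degree u = k"
      using u assms unfolding homogeneous_polys_def by blast+
    ultimately show ?thesis using u False
      by (intro homogeneous_single) (auto simp: in_keys_iff)
  qed
qed

lemma homogeneous_deriv_iter:
  assumes "p \<in> homogeneous_polys n k"
  shows "(partial_deriv j ^^ l) p \<in> homogeneous_polys n (k - l)"
proof (induction l)
  case (Suc l)
  then show ?case using homogeneous_deriv[of "(partial_deriv j ^^ l) p" n "k - l" j] by simp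
qed (use assms in simp)

lemma homogeneous_perturbed:
  assumes "\<And>k. k \<in> {1..m} \<Longrightarrow> a k \<in> homogeneous_polys (n - 1) k" "P \<in> homogeneous_polys n m"
  shows "perturbed n m a s P \<in> homogeneous_polys n m"
  unfolding perturbed_def
proof (intro homogeneous_add homogeneous_sum assms(2))
  fix k assume k: "k \<in> {1..m}"
  have "a k * const_mpoly (s ^ k) * (partial_deriv n ^^ k) P \<in> homogeneous_polys n (k + 0 + (m - k))"
    by (intro homogeneous_mult homogeneous_const homogeneous_deriv_iter assms(2) homogeneous_mono[OF assms(1)[OF k]]) auto
  then show "a k * const_mpoly (s ^ k) * (partial_deriv n ^^ k) P \<in> homogeneous_polys n m" using k by simp
qed

section \<open>Restriction to lines in a coordinate direction\<close>

text \<open>The polynomial in \<open>t\<close> that \<open>P\<close> induces on the line \<open>x + t e\<close>. It is built monomial by monomial and not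
  only described by its values, so that its degree and leading coefficient can be read off.\<close>
definition line_restr :: "nat \<Rightarrow> (nat \<Rightarrow> real) \<Rightarrow> real_mpoly \<Rightarrow> complex poly" where
  "line_restr n x P = (\<Sum>u\<in>Poly_Mapping.keys P. smult (of_real (Poly_Mapping.lookup P u))
     (\<Prod>i\<in>Poly_Mapping.keys u. [:of_real (x i), of_real (axis_vec n i):] ^ Poly_Mapping.lookup u i))"

lemma poly_line_restr: "poly (line_restr n x P) t = eval_mpoly (\<lambda>i. of_real (x i) + t * of_real (axis_vec n i)) P"
  by (simp add: line_restr_def eval_mpoly_def poly_sum poly_prod)

text \<open>Identities between restrictions need only be checked pointwise, so that they reduce to the
  behaviour of evaluation.\<close>
lemma line_restr_eqI: "(\<And>t. eval_mpoly (\<lambda>i. of_real (x i) + t * of_real (axis_vec n i)) P = poly p t) \<Longrightarrow> line_restr n x P = p"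
  by (metis poly_line_restr poly_eq_poly_eq_iff ext)

lemma line_restr_add: "line_restr n x (P + Q) = line_restr n x P + line_restr n x Q"
  by (rule line_restr_eqI) (simp add: eval_mpoly_add poly_line_restr)

lemma line_restr_sum: "line_restr n x (sum f A) = (\<Sum>a\<in>A. line_restr n x (f a))"
  by (rule line_restr_eqI) (simp add: eval_mpoly_sum poly_line_restr poly_sum)

lemma line_restr_mult: "line_restr n x (P * Q) = line_restr n x P * line_restr n x Q"
  by (rule line_restr_eqI) (simp add: eval_mpoly_mult poly_line_restr)

lemma line_restr_const: "line_restr n x (const_mpoly c) = [:of_real c:]"
  by (rule line_restr_eqI) (simp add: eval_mpoly_const)

lemma line_restr_var_power: "line_restr n x (var n ^ k) = [:of_real (x n), 1:] ^ k"
  by (rule line_restr_eqI) (simp add: eval_mpoly_var_power axis_vec_def)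

text \<open>A polynomial in the other variables is constant on every line in direction \<open>x\<^sub>n\<close>; this is why the
  perturbation acts on each line as an operator with constant coefficients.\<close>
lemma line_restr_coeff_poly:
  assumes "p \<in> homogeneous_polys (n - 1) k" "n > 0"
  shows "line_restr n x p = [:of_real (eval_mpoly x p):]"
proof (rule line_restr_eqI)
  fix t :: complex
  have "eval_mpoly (\<lambda>i. of_real (x i) + t * of_real (axis_vec n i)) p = eval_mpoly (\<lambda>i. of_real (x i)) p"
    using assms by (intro eval_mpoly_cong[OF assms(1)]) (auto simp: axis_vec_def)
  then show "eval_mpoly (\<lambda>i. of_real (x i) + t * of_real (axis_vec n i)) p = poly [:of_real (eval_mpoly x p):] t"
    by (simp add: eval_mpoly_of_real)
qed

text \<open>Only the factor \<open>x\<^sub>n\<close> depends on \<open>t\<close>. The set \<open>A\<close> is free so that \<open>u\<close> and the exponent vector of the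
  differentiated monomial, whose support may be smaller, can be compared over the same product.\<close>
lemma line_restr_monomial:
  assumes "finite A" "Poly_Mapping.keys u \<subseteq> A"
  shows "(\<Prod>i\<in>Poly_Mapping.keys u. [:of_real (x i) :: complex, of_real (axis_vec n i):] ^ Poly_Mapping.lookup u i)
    = smult (\<Prod>i\<in>A - {n}. of_real (x i) ^ Poly_Mapping.lookup u i) ([:of_real (x n), 1:] ^ Poly_Mapping.lookup u n)"
proof -
  have "(\<Prod>i\<in>Poly_Mapping.keys u. [:of_real (x i) :: complex, of_real (axis_vec n i):] ^ Poly_Mapping.lookup u i)
    = (\<Prod>i\<in>insert n A. [:of_real (x i) :: complex, of_real (axis_vec n i):] ^ Poly_Mapping.lookup u i)"
    using assms by (intro monomial_superset) auto
  also have "\<dots> = [:of_real (x n), 1:] ^ Poly_Mapping.lookup u n *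
      (\<Prod>i\<in>A - {n}. [:of_real (x i) :: complex, of_real (axis_vec n i):] ^ Poly_Mapping.lookup u i)"
    using assms by (subst prod.insert_remove) (auto simp: axis_vec_def)
  also have "(\<Prod>i\<in>A - {n}. [:of_real (x i) :: complex, of_real (axis_vec n i):] ^ Poly_Mapping.lookup u i)
      = (\<Prod>i\<in>A - {n}. [:of_real (x i) ^ Poly_Mapping.lookup u i:])"
    by (intro prod.cong) (auto simp: axis_vec_def poly_const_pow)
  also have "\<dots> = [:\<Prod>i\<in>A - {n}. of_real (x i) ^ Poly_Mapping.lookup u i:]"
    by (rule poly_eq_poly_eq_iff[THEN iffD1]) (simp add: fun_eq_iff poly_prod)
  finally show ?thesis by simp
qed

lemma line_restr_single: "line_restr n x (Poly_Mapping.single u c) = smult (of_real c)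
     (\<Prod>i\<in>Poly_Mapping.keys u. [:of_real (x i), of_real (axis_vec n i):] ^ Poly_Mapping.lookup u i)"
  by (rule line_restr_eqI) (simp add: eval_mpoly_single poly_prod)

lemma pderiv_linear_power: "pderiv ([:b, 1:] ^ k) = smult (of_nat k) ([:b, 1:] ^ (k - 1))" for b :: "'a::idom"
  by (simp add: pderiv_power pderiv_pCons)

lemma pderiv_sum: "pderiv (sum f A) = (\<Sum>a\<in>A. pderiv (f a))" for f :: "'b \<Rightarrow> 'a::idom poly"
  by (induction A rule: infinite_finite_induct) (simp_all add: pderiv_add)

lemma pderiv_line_restr: "pderiv (line_restr n x P) = line_restr n x (partial_deriv n P)"
proof -
  have "pderiv (\<Prod>i\<in>Poly_Mapping.keys u. [:of_real (x i) :: complex, of_real (axis_vec n i):] ^ Poly_Mapping.lookup u i)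
    = smult (of_nat (Poly_Mapping.lookup u n)) (\<Prod>i\<in>Poly_Mapping.keys (u - Poly_Mapping.single n 1).
       [:of_real (x i), of_real (axis_vec n i):] ^ Poly_Mapping.lookup (u - Poly_Mapping.single n 1) i)" for u
  proof -
    let ?w = "u - Poly_Mapping.single n 1"
    have w: "Poly_Mapping.keys ?w \<subseteq> Poly_Mapping.keys u" by (auto simp: in_keys_iff lookup_minus)
    have "(\<Prod>i\<in>Poly_Mapping.keys u - {n}. complex_of_real (x i) ^ Poly_Mapping.lookup ?w i) =
        (\<Prod>i\<in>Poly_Mapping.keys u - {n}. of_real (x i) ^ Poly_Mapping.lookup u i)"
      by (intro prod.cong) (auto simp: lookup_minus lookup_single)
    then show ?thesis
      unfolding line_restr_monomial[OF finite_keys order_refl, of x n u] line_restr_monomial[OF finite_keys w]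
      by (simp add: lookup_minus pderiv_smult pderiv_linear_power mult_ac)
  qed
  then show ?thesis
    unfolding line_restr_def[of n x P] partial_deriv_def line_restr_sum line_restr_single
    by (simp add: pderiv_sum pderiv_smult mult_ac)
qed

lemma pderiv_iter_line_restr: "(pderiv ^^ k) (line_restr n x P) = line_restr n x ((partial_deriv n ^^ k) P)"
  by (induction k) (simp_all add: pderiv_line_restr)

text \<open>Among the monomials of degree \<open>m\<close> only \<open>x\<^sub>n\<^sup>m\<close> has full degree in \<open>x\<^sub>n\<close>; hence it alone determines the
  coefficient of \<open>t\<^sup>m\<close> of a restriction and the value at multiples of \<open>e\<close>.\<close>
lemma lookup_last_less_degree:
  assumes "P \<in> homogeneous_polys n m" "u \<in> Poly_Mapping.keys P"
  shows "Poly_Mapping.lookup u n \<le> m"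
    and "u \<noteq> Poly_Mapping.single n m \<Longrightarrow> Poly_Mapping.lookup u n < m \<and> (\<exists>i\<in>Poly_Mapping.keys u. i \<noteq> n)"
proof -
  let ?A = "Poly_Mapping.keys u - {n}"
  have m: "m = Poly_Mapping.lookup u n + (\<Sum>i\<in>?A. Poly_Mapping.lookup u i)"
    using assms monomial_degree_superset[of "insert n (Poly_Mapping.keys u)" u]
    by (auto simp: homogeneous_polys_def sum.insert_remove)
  then show "Poly_Mapping.lookup u n \<le> m" by simp
  assume ne: "u \<noteq> Poly_Mapping.single n m"
  have "?A \<noteq> {}"
  proof
    assume "?A = {}"
    then have "u = Poly_Mapping.single n m"
      using m by (intro poly_mapping_eqI) (auto simp: lookup_single when_def in_keys_iff)
    with ne show False by simp
  qed
  then show "Poly_Mapping.lookup u n < m \<and> (\<exists>i\<in>Poly_Mapping.keys u. i \<noteq> n)"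
    using m by (auto simp: in_keys_iff intro!: sum_pos)
qed

lemma eval_mpoly_axis:
  assumes "P \<in> homogeneous_polys n m"
  shows "eval_mpoly (\<lambda>i. t * of_real (axis_vec n i)) P = t ^ m * of_real (Poly_Mapping.lookup P (Poly_Mapping.single n m))"
proof -
  have "eval_mpoly (\<lambda>i. t * of_real (axis_vec n i)) P = eval_mpoly (\<lambda>i. t * of_real (axis_vec n i))
     (Poly_Mapping.single (Poly_Mapping.single n m) (Poly_Mapping.lookup P (Poly_Mapping.single n m)))"
    unfolding eval_mpoly_def
  proof (intro sum.mono_neutral_cong_right)
    show "\<forall>u\<in>Poly_Mapping.keys P - Poly_Mapping.keys (Poly_Mapping.single (Poly_Mapping.single n m) (Poly_Mapping.lookup P (Poly_Mapping.single n m))).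
       of_real (Poly_Mapping.lookup P u) * (\<Prod>i\<in>Poly_Mapping.keys u. (t * of_real (axis_vec n i)) ^ Poly_Mapping.lookup u i) = 0"
    proof
      fix u assume u: "u \<in> Poly_Mapping.keys P - Poly_Mapping.keys (Poly_Mapping.single (Poly_Mapping.single n m) (Poly_Mapping.lookup P (Poly_Mapping.single n m)))"
      then have "u \<noteq> Poly_Mapping.single n m" by (auto simp: in_keys_iff)
      then obtain i where "i \<in> Poly_Mapping.keys u" "i \<noteq> n" using lookup_last_less_degree(2)[OF assms] u by blast
      then have "(\<Prod>i\<in>Poly_Mapping.keys u. (t * of_real (axis_vec n i)) ^ Poly_Mapping.lookup u i) = 0"
        by (intro prod_zero) (auto simp: axis_vec_def in_keys_iff)
      then show "of_real (Poly_Mapping.lookup P u) * (\<Prod>i\<in>Poly_Mapping.keys u. (t * of_real (axis_vec n i)) ^ Poly_Mapping.lookup u i) = 0"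
        by simp
    qed
  qed (auto simp: in_keys_iff split: if_splits)
  also have "\<dots> = t ^ m * of_real (Poly_Mapping.lookup P (Poly_Mapping.single n m))"
    by (simp add: eval_mpoly_single axis_vec_def)
  finally show ?thesis .
qed

text \<open>Grace's theorem needs the restrictions to have exactly \<open>m\<close> roots. Their leading coefficient is the
  coefficient of \<open>x\<^sub>n\<^sup>m\<close>, that is \<open>P(e)\<close>; were it zero, \<open>P(t e) = t\<^sup>m P(e)\<close> would have the root \<open>t = \<i>\<close>.\<close>
lemma degree_line_restr:
  assumes "hyperbolic n m (axis_vec n) P" "m > 0"
  shows "degree (line_restr n x P) = m" "line_restr n x P \<noteq> 0"
proof -
  have P: "P \<in> homogeneous_polys n m" using assms by (simp add: hyperbolic_def)
  have "\<i> \<notin> \<real>" by (simp add: complex_is_Real_iff)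
  then have "eval_mpoly (\<lambda>i. complex_of_real 0 + \<i> * of_real (axis_vec n i)) P \<noteq> 0"
    using assms(1)[unfolded hyperbolic_def, THEN conjunct2, rule_format, of "\<lambda>_. 0" \<i>] by auto
  then have lc: "Poly_Mapping.lookup P (Poly_Mapping.single n m) \<noteq> 0"
    using eval_mpoly_axis[OF P, of \<i>] by auto
  let ?f = "\<lambda>u. smult (complex_of_real (Poly_Mapping.lookup P u))
     (\<Prod>i\<in>Poly_Mapping.keys u. [:of_real (x i), of_real (axis_vec n i):] ^ Poly_Mapping.lookup u i)"
  have deg: "degree (?f u) \<le> Poly_Mapping.lookup u n" for u
    unfolding line_restr_monomial[OF finite_keys order_refl, of x n u]
    by (intro order.trans[OF degree_smult_le]) (simp add: degree_linear_power)
  have le: "degree (line_restr n x P) \<le> m" unfolding line_restr_def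
    by (intro degree_sum_le finite_keys) (rule order.trans[OF deg lookup_last_less_degree(1)[OF P]])
  have "coeff (line_restr n x P) m = (\<Sum>u\<in>Poly_Mapping.keys P. coeff (?f u) m)"
    unfolding line_restr_def coeff_sum ..
  also have "\<dots> = (\<Sum>u\<in>{Poly_Mapping.single n m}. coeff (?f u) m)"
  proof (intro sum.mono_neutral_right ballI)
    fix u assume "u \<in> Poly_Mapping.keys P - {Poly_Mapping.single n m}"
    then have "Poly_Mapping.lookup u n < m" using lookup_last_less_degree(2)[OF P] by blast
    then show "coeff (?f u) m = 0" using deg[of u] by (intro coeff_eq_0) simp
  qed (use lc in \<open>auto simp: in_keys_iff\<close>)
  also have "\<dots> = of_real (Poly_Mapping.lookup P (Poly_Mapping.single n m))"
    using coeff_linear_power[of "complex_of_real (x n)" m] by (simp add: axis_vec_def)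
  finally have c: "coeff (line_restr n x P) m \<noteq> 0" using lc by simp
  then show "degree (line_restr n x P) = m" using le le_degree[OF c] by simp
  show "line_restr n x P \<noteq> 0" using c by auto
qed

text \<open>By homogeneity \<open>a\<^sub>k(x) s\<^sup>k = a\<^sub>k(s x)\<close>: on the line through \<open>x\<close> the perturbation with parameter \<open>s\<close> is
  the operator that the perturbation with parameter \<open>1\<close> induces on the line through \<open>s x\<close>.\<close>
lemma line_restr_perturbed:
  assumes "n > 0" "\<And>k. k \<in> {1..m} \<Longrightarrow> a k \<in> homogeneous_polys (n - 1) k"
  shows "line_restr n x (perturbed n m a s P) =
    diff_operator m (\<lambda>k. if k = 0 then 1 else of_real (eval_mpoly (\<lambda>i. s * x i) (a k))) (line_restr n x P)"
proof -
  have "line_restr n x (a k * const_mpoly (s ^ k) * (partial_deriv n ^^ k) P) =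
      smult (of_real (eval_mpoly (\<lambda>i. s * x i) (a k))) ((pderiv ^^ k) (line_restr n x P))" if "k \<in> {1..m}" for k
    by (simp add: line_restr_mult line_restr_const line_restr_coeff_poly[OF assms(2)[OF that] assms(1)] pderiv_iter_line_restr
        eval_mpoly_scale[OF assms(2)[OF that]] mult_ac)
  then have "line_restr n x (perturbed n m a s P) = line_restr n x P +
     (\<Sum>k=1..m. smult (of_real (eval_mpoly (\<lambda>i. s * x i) (a k))) ((pderiv ^^ k) (line_restr n x P)))"
    by (simp add: perturbed_def line_restr_add line_restr_sum)
  also have "\<dots> = diff_operator m (\<lambda>k. if k = 0 then 1 else of_real (eval_mpoly (\<lambda>i. s * x i) (a k))) (line_restr n x P)"
  proof -
    have "{..m} = insert 0 {1..m}" by auto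
    then show ?thesis by (simp add: diff_operator_def)
  qed
  finally show ?thesis .
qed

text \<open>Real coefficients make the roots symmetric under conjugation, so the upper half-plane decides
  hyperbolicity.\<close>
lemma hyperbolic_iff_upper:
  "hyperbolic n m (axis_vec n) P \<longleftrightarrow> P \<in> homogeneous_polys n m \<and> (\<forall>x t. Im t > 0 \<longrightarrow> poly (line_restr n x P) t \<noteq> 0)"
proof -
  have "poly (line_restr n x P) (cnj t) = cnj (poly (line_restr n x P) t)" for x t
    by (simp add: poly_line_restr flip: eval_mpoly_cnj)
  then have "t \<in> \<real>" if "\<forall>t. Im t > 0 \<longrightarrow> poly (line_restr n x P) t \<noteq> 0" "poly (line_restr n x P) t = 0" for x t
    using that(1)[rule_format, of t] that(1)[rule_format, of "cnj t"] that(2)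
    by (cases "Im t" "0::real" rule: linorder_cases) (auto simp: complex_is_Real_iff)
  moreover have "Im t \<le> 0" if "t \<in> \<real>" for t using that by (simp add: complex_is_Real_iff)
  ultimately show ?thesis unfolding hyperbolic_def poly_line_restr[symmetric] by (meson not_less)
qed

section \<open>Garding Nuij sequences\<close>

theorem theorem3:
  fixes m n :: nat and a :: "nat \<Rightarrow> real_mpoly"
  assumes "m > 0" and "n > 0"
    and "\<And>k. 1 \<le> k \<Longrightarrow> k \<le> m \<Longrightarrow> a k \<in> homogeneous_polys (n - 1) k"
  shows "Garding_Nuij n m a \<longleftrightarrow>
    hyperbolic n m (axis_vec n)
      (var n ^ m + (\<Sum>k=1..m. a k * (partial_deriv n ^^ k) (var n ^ m)))"
proof -
  have a: "a k \<in> homogeneous_polys (n - 1) k" if "k \<in> {1..m}" for k using assms(3) that by simp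
  have slice: "line_restr n x (perturbed n m a s P) =
    diff_operator m (\<lambda>k. if k = 0 then 1 else of_real (eval_mpoly (\<lambda>i. s * x i) (a k))) (line_restr n x P)" for x s P
    using assms(2) a by (rule line_restr_perturbed)
  have Q: "var n ^ m + (\<Sum>k=1..m. a k * (partial_deriv n ^^ k) (var n ^ m)) = perturbed n m a 1 (var n ^ m)"
    by (simp add: perturbed_def const_mpoly_def)
  \<comment> \<open>\<open>Q\<^sub>a\<close> is the perturbation with \<open>s = 1\<close> of \<open>x\<^sub>n\<^sup>m\<close>, itself hyperbolic: one direction is immediate.\<close>
  show ?thesis unfolding Q
  proof
    have "var n ^ m \<in> homogeneous_polys n m"
      unfolding var_power_eq_single using assms(2) by (intro homogeneous_single) (auto simp: monomial_degree_def)
    then have "hyperbolic n m (axis_vec n) (var n ^ m)"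
      by (auto simp: hyperbolic_iff_upper line_restr_var_power dest!: arg_cong[of _ _ Im])
    then show "hyperbolic n m (axis_vec n) (perturbed n m a 1 (var n ^ m))" if "Garding_Nuij n m a"
      using that by (simp add: Garding_Nuij_def)
  next
    assume Q: "hyperbolic n m (axis_vec n) (perturbed n m a 1 (var n ^ m))"
    show "Garding_Nuij n m a"
      unfolding Garding_Nuij_def
    proof (intro conjI ballI allI impI a)
      fix P s assume P: "hyperbolic n m (axis_vec n) P"
      have "poly (line_restr n x (perturbed n m a s P)) t \<noteq> 0" if "Im t > 0" for x t
        unfolding slice
      proof (rule diff_operator_nonzero_upper_half_plane[OF degree_line_restr[OF P assms(1)] _ _ that])
        show "Im r \<le> 0" if "poly (line_restr n x P) r = 0" for r
          using P that by (metis hyperbolic_iff_upper not_less)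
        \<comment> \<open>Hyperbolicity of \<open>Q\<^sub>a\<close> is used on the line through \<open>s x\<close>, not through \<open>x\<close>.\<close>
        show "poly (diff_operator m (\<lambda>k. if k = 0 then 1 else of_real (eval_mpoly (\<lambda>i. s * x i) (a k)))
            ([:complex_of_real (s * x n), 1:] ^ m)) w \<noteq> 0" if "Im w > 0" for w
          using Q that slice[of "\<lambda>i. s * x i" 1 "var n ^ m"]
          unfolding hyperbolic_iff_upper line_restr_var_power mult_1 by metis
      qed
      then show "hyperbolic n m (axis_vec n) (perturbed n m a s P)"
        using P a homogeneous_perturbed by (simp add: hyperbolic_iff_upper)
    qed
  qed
qed

end
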